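(* For each pointed $\Pi$-model $(M,w)$ and $\Pi$-program $\Lambda$ of $\mathrm{GGMSC}$, $M,w\models\Lambda$ if and only if Eloise has a winning strategy in the semantic game $\mathcal{G}(M,w,\Lambda)$.
   Context: $\mathrm{GGMSC}$ programs: over proposition symbols $\Pi$ and schema variables $\mathcal{T}$, each $X\in\mathcal{T}$ has a base rule $X(0) :- \varphi_X$ with $\varphi_X$ a formula of graded modal logic with counting global modality ($\bot,\top,p,\neg,\lor,\land,\Diamond_{\geq k},\Box_{<k},\langle E\rangle_{\geq k},[E]_{<k}$) and an induction rule $X :- \psi_X$ where $\psi_X$ may also contain variables of $\mathcal{T}$ as atoms; there is a set of accepting predicates. $X^0:=\varphi_X$, $X^{n+1}$ is $\psi_X$ with each $Y$ replaced by $Y^n$; $M,w\models\Lambda$ iff $M,w\models X^n$ for some $n$ and some accepting $X$. The game $\mathcal{G}(M,w,\Lambda)$, $M=(W,R,V)$, is between Eloise and Abelard; positions are $(\mathbf{V},v,\varphi,\ell)$ with verifier $\mathbf{V}$, node $v$, subschema $\varphi$ of $\Lambda$, round $\ell\in\mathbb{N}$. Eloise first picks an initial position $(\mathrm{Eloise},w,\varphi,\ell)$ with $\varphi$ the base or induction body of an accepting predicate (she loses if there is none). Rules: at $\top$ (resp. $\bot$) the verifier (resp. falsifier) wins; at $p$ the verifier wins iff $p\in V(v)$; at $\neg\psi$ the roles swap; at $\psi\land\theta$ the falsifier, at $\psi\lor\theta$ the verifier chooses a conjunct/disjunct; at $\Diamond_{\geq k}\psi$ the verifier picks $k$ distinct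 $R$-successors of $v$ (losing if impossible), the falsifier picks one $u$ and play continues at $(\mathbf{V},u,\psi,\ell)$; $\Box_{<k}$ is the same with roles switched; $\langle E\rangle_{\geq k}$, $[E]_{<k}$ are analogous with nodes chosen from all of $W$; at a variable $X$, if $\ell>0$ continue at $(\mathbf{V},v,\psi_X,\ell-1)$, and if $\ell=0$ continue at $(\mathbf{V},v,\varphi_X,0)$. *)

theory Defs
  imports Main
begin

section \<open>Syntax\<close>

text \<open>
  Formulas and \<open>\<T>\<close>-schemata share one datatype: a formula of graded modal logic with
  counting global modality is a schema without variables.
\<close>

datatype (props: 'p, svars: 'x) schema =
    Top
  | Bot
  | Prp 'p
  | Var 'x
  | Neg "('p, 'x) schema"
  | Or "('p, 'x) schema" "('p, 'x) schema"
  | And "('p, 'x) schema" "('p, 'x) schema"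
  | Dia nat "('p, 'x) schema"    \<comment> \<open>\<open>\<Diamond>\<^sub>\<ge>\<^sub>k\<close>\<close>
  | Box nat "('p, 'x) schema"    \<comment> \<open>\<open>\<box>\<^sub><\<^sub>k\<close>\<close>
  | GDia nat "('p, 'x) schema"   \<comment> \<open>\<open>\<langle>E\<rangle>\<^sub>\<ge>\<^sub>k\<close>\<close>
  | GBox nat "('p, 'x) schema"   \<comment> \<open>\<open>[E]\<^sub><\<^sub>k\<close>\<close>

record ('p, 'x) program =
  vars :: "'x set"
  base_body :: "'x \<Rightarrow> ('p, 'x) schema"
  ind_body :: "'x \<Rightarrow> ('p, 'x) schema"
  accepting :: "'x set"

definition program_over :: "'p set \<Rightarrow> ('p, 'x) program \<Rightarrow> bool" where
  "program_over Pi L \<longleftrightarrow>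
     accepting L \<subseteq> vars L \<and>
     (\<forall>X \<in> vars L.
        props (base_body L X) \<subseteq> Pi \<and> svars (base_body L X) = {} \<and>
        props (ind_body L X) \<subseteq> Pi \<and> svars (ind_body L X) \<subseteq> vars L)"


section \<open>Models and semantics\<close>

record ('w, 'p) model =
  worlds :: "'w set"
  rel :: "('w \<times> 'w) set"
  val :: "'w \<Rightarrow> 'p set"

definition model_over :: "'p set \<Rightarrow> ('w, 'p) model \<Rightarrow> bool" where
  "model_over Pi M \<longleftrightarrow>
     worlds M \<noteq> {} \<and> rel M \<subseteq> worlds M \<times> worlds M \<and> (\<forall>v \<in> worlds M. val M v \<subseteq> Pi)"

definition succs :: "('w, 'p) model \<Rightarrow> 'w \<Rightarrow> 'w set" where
  "succs M v = {u. (v, u) \<in> rel M}"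

text \<open>Models may be infinite, and \<open>card\<close> is \<open>0\<close> on infinite sets.\<close>

definition at_least :: "nat \<Rightarrow> 'a set \<Rightarrow> bool" where
  "at_least k A \<longleftrightarrow> infinite A \<or> k \<le> card A"

text \<open>
  \<open>\<box>\<^sub><\<^sub>k \<phi>\<close> is the dual \<open>\<not> \<Diamond>\<^sub>\<ge>\<^sub>k \<not> \<phi>\<close>: fewer than \<open>k\<close> successors violate \<open>\<phi>\<close>; likewise
  \<open>[E]\<^sub><\<^sub>k\<close> and \<open>\<langle>E\<rangle>\<^sub>\<ge>\<^sub>k\<close>. Satisfaction is only meant for variable-free schemata; the value at
  \<open>Var\<close> is arbitrary.
\<close>

fun sat :: "('w, 'p) model \<Rightarrow> 'w \<Rightarrow> ('p, 'x) schema \<Rightarrow> bool" where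
  "sat M v Top \<longleftrightarrow> True"
| "sat M v Bot \<longleftrightarrow> False"
| "sat M v (Prp p) \<longleftrightarrow> p \<in> val M v"
| "sat M v (Var X) \<longleftrightarrow> False"
| "sat M v (Neg \<psi>) \<longleftrightarrow> \<not> sat M v \<psi>"
| "sat M v (Or \<psi> \<theta>) \<longleftrightarrow> sat M v \<psi> \<or> sat M v \<theta>"
| "sat M v (And \<psi> \<theta>) \<longleftrightarrow> sat M v \<psi> \<and> sat M v \<theta>"
| "sat M v (Dia k \<psi>) \<longleftrightarrow> at_least k {u \<in> succs M v. sat M u \<psi>}"
| "sat M v (Box k \<psi>) \<longleftrightarrow> \<not> at_least k {u \<in> succs M v. \<not> sat M u \<psi>}"
| "sat M v (GDia k \<psi>) \<longleftrightarrow> at_least k {u \<in> worlds M. sat M u \<psi>}"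
| "sat M v (GBox k \<psi>) \<longleftrightarrow> \<not> at_least k {u \<in> worlds M. \<not> sat M u \<psi>}"

fun subst :: "('x \<Rightarrow> ('p, 'x) schema) \<Rightarrow> ('p, 'x) schema \<Rightarrow> ('p, 'x) schema" where
  "subst s Top = Top"
| "subst s Bot = Bot"
| "subst s (Prp p) = Prp p"
| "subst s (Var X) = s X"
| "subst s (Neg \<psi>) = Neg (subst s \<psi>)"
| "subst s (Or \<psi> \<theta>) = Or (subst s \<psi>) (subst s \<theta>)"
| "subst s (And \<psi> \<theta>) = And (subst s \<psi>) (subst s \<theta>)"
| "subst s (Dia k \<psi>) = Dia k (subst s \<psi>)"
| "subst s (Box k \<psi>) = Box k (subst s \<psi>)"
| "subst s (GDia k \<psi>) = GDia k (subst s \<psi>)"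
| "subst s (GBox k \<psi>) = GBox k (subst s \<psi>)"

text \<open>\<open>iteration L n X\<close> is the formula \<open>X\<^sup>n\<close>.\<close>

fun iteration :: "('p, 'x) program \<Rightarrow> nat \<Rightarrow> 'x \<Rightarrow> ('p, 'x) schema" where
  "iteration L 0 X = base_body L X"
| "iteration L (Suc n) X = subst (iteration L n) (ind_body L X)"

definition program_sat :: "('w, 'p) model \<Rightarrow> 'w \<Rightarrow> ('p, 'x) program \<Rightarrow> bool" where
  "program_sat M w L \<longleftrightarrow> (\<exists>n. \<exists>X \<in> accepting L. sat M w (iteration L n X))"


section \<open>Two-player games and strategies\<close>

datatype player = Eloise | Abelard

fun opponent :: "player \<Rightarrow> player" where
  "opponent Eloise = Abelard"
| "opponent Abelard = Eloise"

text \<open>\<open>winner\<close> matters only at positions without moves, and \<open>turn\<close> only at positions with moves.\<close>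

record 'q game =
  start :: 'q
  moves :: "'q \<Rightarrow> 'q set"
  turn :: "'q \<Rightarrow> player"
  winner :: "'q \<Rightarrow> player"

definition history :: "'q game \<Rightarrow> 'q list \<Rightarrow> bool" where
  "history G h \<longleftrightarrow>
     h \<noteq> [] \<and> hd h = start G \<and>
     (\<forall>i. Suc i < length h \<longrightarrow> h ! Suc i \<in> moves G (h ! i))"

definition infinite_play :: "'q game \<Rightarrow> (nat \<Rightarrow> 'q) \<Rightarrow> bool" where
  "infinite_play G f \<longleftrightarrow> f 0 = start G \<and> (\<forall>i. f (Suc i) \<in> moves G (f i))"

text \<open>A strategy of a player maps each history at which that player has to move to a legal move.\<close>

definition strategy :: "'q game \<Rightarrow> player \<Rightarrow> ('q list \<Rightarrow> 'q) \<Rightarrow> bool" where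
  "strategy G P \<sigma> \<longleftrightarrow>
     (\<forall>h. history G h \<and> turn G (last h) = P \<and> moves G (last h) \<noteq> {} \<longrightarrow>
          \<sigma> h \<in> moves G (last h))"

definition follows :: "'q game \<Rightarrow> player \<Rightarrow> ('q list \<Rightarrow> 'q) \<Rightarrow> 'q list \<Rightarrow> bool" where
  "follows G P \<sigma> h \<longleftrightarrow>
     (\<forall>i. Suc i < length h \<and> turn G (h ! i) = P \<longrightarrow> h ! Suc i = \<sigma> (take (Suc i) h))"

text \<open>
  A strategy is winning if every play following it ends after finitely many moves, at a
  position won by its player.
\<close>

definition winning_strategy :: "'q game \<Rightarrow> player \<Rightarrow> ('q list \<Rightarrow> 'q) \<Rightarrow> bool" where
  "winning_strategy G P \<sigma> \<longleftrightarrow>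
     strategy G P \<sigma> \<and>
     (\<forall>h. history G h \<and> follows G P \<sigma> h \<and> moves G (last h) = {} \<longrightarrow> winner G (last h) = P) \<and>
     \<not> (\<exists>f. infinite_play G f \<and> (\<forall>n. follows G P \<sigma> (map f [0..<n])))"


section \<open>The semantic game\<close>

text \<open>
  \<open>Pos V v \<phi> l\<close> is the position \<open>(V, v, \<phi>, l)\<close>. The move at a modal operator has two stages:
  \<open>Pick C V S \<psi> l\<close> is the intermediate position in which a set \<open>S\<close> of \<open>k\<close> nodes has been chosen
  and player \<open>C\<close> has to pick some \<open>u \<in> S\<close>, continuing at \<open>Pos V u \<psi> l\<close>. In \<open>Init\<close>, Eloise has to
  choose the initial position.
\<close>

datatype ('w, 'p, 'x) position =
    Init
  | Pos player 'w "('p, 'x) schema" nat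
  | Pick player player "'w set" "('p, 'x) schema" nat

definition ksubsets :: "nat \<Rightarrow> 'a set \<Rightarrow> 'a set set" where
  "ksubsets k A = {S. S \<subseteq> A \<and> finite S \<and> card S = k}"

fun sg_moves :: "('w, 'p) model \<Rightarrow> 'w \<Rightarrow> ('p, 'x) program \<Rightarrow>
    ('w, 'p, 'x) position \<Rightarrow> ('w, 'p, 'x) position set" where
  "sg_moves M w L Init =
     {Pos Eloise w \<phi> l |\<phi> l. \<exists>X \<in> accepting L. \<phi> = base_body L X \<or> \<phi> = ind_body L X}"
| "sg_moves M w L (Pick C V S \<psi> l) = {Pos V u \<psi> l |u. u \<in> S}"
| "sg_moves M w L (Pos V v Top l) = {}"
| "sg_moves M w L (Pos V v Bot l) = {}"
| "sg_moves M w L (Pos V v (Prp p) l) = {}"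
| "sg_moves M w L (Pos V v (Var X) l) =
     {if l > 0 then Pos V v (ind_body L X) (l - 1) else Pos V v (base_body L X) 0}"
| "sg_moves M w L (Pos V v (Neg \<psi>) l) = {Pos (opponent V) v \<psi> l}"
| "sg_moves M w L (Pos V v (Or \<psi> \<theta>) l) = {Pos V v \<psi> l, Pos V v \<theta> l}"
| "sg_moves M w L (Pos V v (And \<psi> \<theta>) l) = {Pos V v \<psi> l, Pos V v \<theta> l}"
| "sg_moves M w L (Pos V v (Dia k \<psi>) l) =
     {Pick (opponent V) V S \<psi> l |S. S \<in> ksubsets k (succs M v)}"
| "sg_moves M w L (Pos V v (Box k \<psi>) l) =
     {Pick V V S \<psi> l |S. S \<in> ksubsets k (succs M v)}"
| "sg_moves M w L (Pos V v (GDia k \<psi>) l) =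
     {Pick (opponent V) V S \<psi> l |S. S \<in> ksubsets k (worlds M)}"
| "sg_moves M w L (Pos V v (GBox k \<psi>) l) =
     {Pick V V S \<psi> l |S. S \<in> ksubsets k (worlds M)}"

text \<open>At negations and variables the only move is forced, so it does not matter who makes it.\<close>

fun sg_turn :: "('w, 'p, 'x) position \<Rightarrow> player" where
  "sg_turn Init = Eloise"
| "sg_turn (Pick C V S \<psi> l) = C"
| "sg_turn (Pos V v (And \<psi> \<theta>) l) = opponent V"
| "sg_turn (Pos V v (Box k \<psi>) l) = opponent V"
| "sg_turn (Pos V v (GBox k \<psi>) l) = opponent V"
| "sg_turn (Pos V v \<phi> l) = V"

text \<open>
  Outside atoms, a player who has to choose but cannot loses. This includes picking an
  element of the empty set when \<open>k = 0\<close>, in accordance with \<open>\<Diamond>\<^sub>\<ge>\<^sub>0 \<psi>\<close> being valid.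
\<close>

fun sg_winner :: "('w, 'p) model \<Rightarrow> ('w, 'p, 'x) position \<Rightarrow> player" where
  "sg_winner M (Pos V v Top l) = V"
| "sg_winner M (Pos V v Bot l) = opponent V"
| "sg_winner M (Pos V v (Prp p) l) = (if p \<in> val M v then V else opponent V)"
| "sg_winner M q = opponent (sg_turn q)"

definition semantic_game :: "('w, 'p) model \<Rightarrow> 'w \<Rightarrow> ('p, 'x) program \<Rightarrow>
    ('w, 'p, 'x) position game" where
  "semantic_game M w L =
     \<lparr>start = Init, moves = sg_moves M w L, turn = sg_turn, winner = sg_winner M\<rparr>"

end

(* Each position carries a truth value: Pos V v \<phi> l is good for Eloise iff V is Eloise exactly when v
   satisfies \<phi> with every variable Y replaced by Y^l. A player who has to move can keep the value
   iff it is in their favour, and since every play is finite, the value at the start decides who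
   wins. Plays are finite because the round counter never increases, drops at variables, and at
   round 0 a variable leads to a variable-free base body. *)

theory Submission imports Defs begin

section \<open>Winning strategies in well-founded games\<close>

lemma history_snoc:
  assumes "history G h" and "q \<in> moves G (last h)"
  shows "history G (h @ [q])"
proof -
  have "(h @ [q]) ! Suc i \<in> moves G ((h @ [q]) ! i)" if "Suc i < length (h @ [q])" for i
  proof (cases "Suc i < length h")
    case True
    then show ?thesis using assms(1) by (simp add: history_def nth_append)
  next
    case False
    then have "length h = Suc i" using that by simp
    then show ?thesis using assms by (auto simp: history_def nth_append last_conv_nth)
  qed
  then show ?thesis using assms(1) by (simp add: history_def)
qed

lemma follows_snoc:
  assumes "h \<noteq> []" and "follows G P \<sigma> h" and "turn G (last h) = P \<Longrightarrow> q = \<sigma> h"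
  shows "follows G P \<sigma> (h @ [q])"
  unfolding follows_def
proof (intro allI impI, elim conjE)
  fix i assume i: "Suc i < length (h @ [q])" and t: "turn G ((h @ [q]) ! i) = P"
  show "(h @ [q]) ! Suc i = \<sigma> (take (Suc i) (h @ [q]))"
  proof (cases "Suc i < length h")
    case True
    then show ?thesis using assms(2) t by (simp add: follows_def nth_append)
  next
    case False
    then have "length h = Suc i" using i by simp
    then show ?thesis using assms(1,3) t by (simp add: nth_append last_conv_nth)
  qed
qed

lemma history_invariant:
  assumes "history G h" and "start G \<in> Q"
    and "\<And>i. Suc i < length h \<Longrightarrow> h ! i \<in> Q \<Longrightarrow> h ! Suc i \<in> Q"
  shows "last h \<in> Q"
proof -
  have "i < length h \<longrightarrow> h ! i \<in> Q" for i
    using assms by (induction i) (auto simp: history_def hd_conv_nth)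
  then show ?thesis using assms(1) by (auto simp: history_def last_conv_nth)
qed

text \<open>This is the backward-induction equation at a single position; a \<open>good\<close> that
  solves it throughout a well-founded game is the winning region of \<open>P\<close>.\<close>

definition consistent_at :: "'q game \<Rightarrow> player \<Rightarrow> ('q \<Rightarrow> bool) \<Rightarrow> 'q \<Rightarrow> bool" where
  "consistent_at G P good q \<longleftrightarrow>
     good q = (if moves G q = {} then winner G q = P
               else if turn G q = P then \<exists>q' \<in> moves G q. good q'
               else \<forall>q' \<in> moves G q. good q')"

text \<open>From a good start, moving to a good position whenever possible keeps play in the good
  region until it ends there. Conversely, well-founded induction shows every position reached under
  a winning strategy to be good. The set \<open>Q\<close> confines well-foundedness and consistency
  to a region that play cannot leave.\<close>

lemma winning_strategy_exists_iff:
  fixes G :: "'q game"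
  assumes wf: "wf {(q', q). q \<in> Q \<and> q' \<in> moves G q}"
    and start: "start G \<in> Q"
    and closed: "\<And>q q'. q \<in> Q \<Longrightarrow> q' \<in> moves G q \<Longrightarrow> q' \<in> Q"
    and consistent: "\<And>q. q \<in> Q \<Longrightarrow> consistent_at G P good q"
  shows "(\<exists>\<sigma>. winning_strategy G P \<sigma>) \<longleftrightarrow> good (start G)"
proof
  assume good: "good (start G)"
  \<comment> \<open>Only the last position matters; if no move is good, an arbitrary legal one still
    makes \<open>\<sigma>\<close> a strategy.\<close>
  define \<sigma> where "\<sigma> h = (SOME q. q \<in> moves G (last h) \<and>
    ((\<exists>q' \<in> moves G (last h). good q') \<longrightarrow> good q))" for h
  have \<sigma>: "\<sigma> h \<in> moves G (last h) \<and> ((\<exists>q' \<in> moves G (last h). good q') \<longrightarrow> good (\<sigma> h))"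
    if "moves G (last h) \<noteq> {}" for h
    unfolding \<sigma>_def by (rule someI_ex) (use that in blast)
  have "winner G (last h) = P"
    if h: "history G h" "follows G P \<sigma> h" "moves G (last h) = {}" for h
  proof -
    have "last h \<in> {q \<in> Q. good q}"
    proof (rule history_invariant[OF h(1)])
      show "start G \<in> {q \<in> Q. good q}" using start good by simp
      fix i assume i: "Suc i < length h" and q: "h ! i \<in> {q \<in> Q. good q}"
      have m: "h ! Suc i \<in> moves G (h ! i)" using h(1) i by (simp add: history_def)
      have l: "last (take (Suc i) h) = h ! i" using i by (simp add: take_Suc_conv_app_nth)
      have "good (h ! Suc i)"
      proof (cases "turn G (h ! i) = P")
        case True
        then have "h ! Suc i = \<sigma> (take (Suc i) h)" using h(2) i by (simp add: follows_def)
        moreover from m have "moves G (h ! i) \<noteq> {}" by blast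
        then have "\<exists>q' \<in> moves G (h ! i). good q'"
          using consistent[of "h ! i"] q unfolding consistent_at_def if_P[OF True] by simp
        ultimately show ?thesis using \<sigma>[of "take (Suc i) h"] m l by auto
      next
        case False
        then show ?thesis
          using consistent[of "h ! i"] q m by (auto simp: consistent_at_def split: if_splits)
      qed
      then show "h ! Suc i \<in> {q \<in> Q. good q}" using closed q m by blast
    qed
    then show ?thesis using consistent[of "last h"] h(3) by (simp add: consistent_at_def)
  qed
  \<comment> \<open>Well-foundedness excludes infinite plays altogether, whether or not they follow
    \<open>\<sigma>\<close>.\<close>
  moreover have "\<not> infinite_play G f" for f
  proof
    assume f: "infinite_play G f"
    have "f i \<in> Q" for i
      by (induction i) (use f start closed in \<open>auto simp: infinite_play_def\<close>)
    then have "\<forall>i. (f (Suc i), f i) \<in> {(q', q). q \<in> Q \<and> q' \<in> moves G q}"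
      using f by (simp add: infinite_play_def)
    then show False using wf by (auto simp: wf_iff_no_infinite_down_chain)
  qed
  ultimately have "winning_strategy G P \<sigma>"
    using \<sigma> by (auto simp: winning_strategy_def strategy_def)
  then show "\<exists>\<sigma>. winning_strategy G P \<sigma>" by blast
next
  assume "\<exists>\<sigma>. winning_strategy G P \<sigma>"
  then obtain \<sigma> where \<sigma>: "strategy G P \<sigma>"
    "\<And>h. history G h \<Longrightarrow> follows G P \<sigma> h \<Longrightarrow> moves G (last h) = {} \<Longrightarrow> winner G (last h) = P"
    unfolding winning_strategy_def by blast
  \<comment> \<open>The claim ranges over all \<open>h\<close> because \<open>\<sigma>\<close> may
    answer differently after different histories ending in the same position.\<close>
  have "good q"
    if "q \<in> Q" "history G h" "follows G P \<sigma> h" "last h = q" for q h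
    using wf that
  proof (induction q arbitrary: h rule: wf_induct_rule)
    case (less q)
    \<comment> \<open>At a turn of \<open>P\<close> only the answer of \<open>\<sigma>\<close>
      extends \<open>h\<close> to a history following it; at the opponent's turns every move
      does.\<close>
    have snoc: "good q'" if q': "q' \<in> moves G q" "turn G q = P \<Longrightarrow> q' = \<sigma> h" for q'
    proof (rule less.IH)
      show "(q', q) \<in> {(q', q). q \<in> Q \<and> q' \<in> moves G q}" using q'(1) less.prems(1) by simp
      show "q' \<in> Q" by (rule closed[OF less.prems(1) q'(1)])
      show "history G (h @ [q'])"
        by (rule history_snoc[OF less.prems(2)]) (simp add: less.prems(4) q'(1))
      have "h \<noteq> []" using less.prems(2) by (simp add: history_def)
      then show "follows G P \<sigma> (h @ [q'])"
        by (rule follows_snoc[OF _ less.prems(3)]) (simp add: less.prems(4) q'(2))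
    qed simp
    consider "moves G q = {}" | "moves G q \<noteq> {}" "turn G q = P" | "moves G q \<noteq> {}" "turn G q \<noteq> P"
      by blast
    then show "good q"
    proof cases
      case 1
      then have "winner G q = P" using \<sigma>(2)[OF less.prems(2,3)] less.prems(4) by simp
      then show ?thesis using consistent[OF less.prems(1)] 1 by (simp add: consistent_at_def)
    next
      case 2
      then have "\<sigma> h \<in> moves G q"
        using \<sigma>(1) less.prems(2,4) by (auto simp: strategy_def)
      then show ?thesis
        using consistent[OF less.prems(1)] 2 snoc by (auto simp: consistent_at_def)
    next
      case 3
      then show ?thesis
        using consistent[OF less.prems(1)] snoc by (auto simp: consistent_at_def)
    qed
  qed
  moreover have "history G [start G]" "follows G P \<sigma> [start G]"
    by (simp_all add: history_def follows_def)
  ultimately show "good (start G)" using start by (metis last.simps)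
qed

section \<open>Counting as the choice of a set of nodes\<close>

lemma at_least_iff_ksubsets: "at_least k A \<longleftrightarrow> ksubsets k A \<noteq> {}"
proof
  assume "at_least k A"
  then obtain S where "S \<subseteq> A" "finite S" "card S = k"
    unfolding at_least_def
    by (metis infinite_arbitrarily_large obtain_subset_with_card_n)
  then show "ksubsets k A \<noteq> {}" by (auto simp: ksubsets_def)
qed (auto simp: at_least_def ksubsets_def card_mono)

text \<open>This matches the two stages of a modal move: one player proposes \<open>k\<close> nodes,
  the other picks among them. Applied to a negated property it also covers the boxes.\<close>

lemma at_least_Collect_iff:
  "at_least k {u \<in> A. Q u} \<longleftrightarrow> (\<exists>S \<in> ksubsets k A. \<forall>u \<in> S. Q u)"
  unfolding at_least_iff_ksubsets by (auto simp: ksubsets_def subset_iff)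

lemma subst_var_free: "svars \<phi> = {} \<Longrightarrow> subst s \<phi> = \<phi>"
  by (induction \<phi>) auto

lemma all_image_iff: "(\<forall>y. (\<exists>x. y = f x \<and> x \<in> A) \<longrightarrow> P y) \<longleftrightarrow> (\<forall>x \<in> A. P (f x))"
  by blast

lemma ex_image_iff: "(\<exists>y. (\<exists>x. y = f x \<and> x \<in> A) \<and> P y) \<longleftrightarrow> (\<exists>x \<in> A. P (f x))"
  by blast

lemma opponent_eq_iff: "opponent V = Eloise \<longleftrightarrow> V \<noteq> Eloise"
  by (cases V) auto

section \<open>Truth values, termination and local consistency of the semantic game\<close>

text \<open>In a \<open>Pick\<close> the quantifier scopes over the whole equivalence, so it ranges
  over the values of the possible continuations.\<close>

fun eloise_good :: "('w, 'p) model \<Rightarrow> 'w \<Rightarrow> ('p, 'x) program \<Rightarrow> ('w, 'p, 'x) position \<Rightarrow> bool" where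
  "eloise_good M w L Init = program_sat M w L"
| "eloise_good M w L (Pos V v \<phi> l) = (sat M v (subst (iteration L l) \<phi>) \<longleftrightarrow> V = Eloise)"
| "eloise_good M w L (Pick C V S \<psi> l) =
     (if C = Eloise then \<exists>u \<in> S. sat M u (subst (iteration L l) \<psi>) \<longleftrightarrow> V = Eloise
      else \<forall>u \<in> S. sat M u (subst (iteration L l) \<psi>) \<longleftrightarrow> V = Eloise)"

text \<open>Restricting to schemata over \<^term>\<open>vars L\<close> matters: bodies of other variables are
  unconstrained, and a base body there could be its own variable, giving an infinite play.\<close>

fun legal :: "('p, 'x) program \<Rightarrow> ('w, 'p, 'x) position \<Rightarrow> bool" where
  "legal L Init = True"
| "legal L (Pos V v \<phi> l) = (svars \<phi> \<subseteq> vars L)"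
| "legal L (Pick C V S \<psi> l) = (svars \<psi> \<subseteq> vars L)"

lemma legal_move:
  assumes "program_over Pi L" "legal L q" "q' \<in> sg_moves M w L q"
  shows "legal L q'"
  using assms
  by (induction M w L q rule: sg_moves.induct) (auto simp: program_over_def split: if_splits)

text \<open>The second component is one higher while variables remain, so it drops at a variable
  even in round 0, where the base body is variable-free. Doubling the sizes leaves room for a
  \<open>Pick\<close> strictly between a modal schema and its operand.\<close>

fun rank :: "('w, 'p, 'x) position \<Rightarrow> nat \<times> nat \<times> nat" where
  "rank Init = (1, 0, 0)"
| "rank (Pos V v \<phi> l) = (0, if svars \<phi> = {} then l else Suc l, 2 * size \<phi>)"
| "rank (Pick C V S \<psi> l) = (0, if svars \<psi> = {} then l else Suc l, Suc (2 * size \<psi>))"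

lemma rank_move:
  assumes "program_over Pi L" "legal L q" "q' \<in> sg_moves M w L q"
  shows "(rank q', rank q) \<in> less_than <*lex*> less_than <*lex*> less_than"
  using assms
  by (induction M w L q rule: sg_moves.induct) (auto simp: program_over_def split: if_splits)

lemma wf_sg_moves:
  assumes "program_over Pi L"
  shows "wf {(q', q). q \<in> Collect (legal L) \<and> q' \<in> sg_moves M w L q}"
proof (rule wf_subset)
  show "wf (inv_image (less_than <*lex*> less_than <*lex*> less_than) rank)"
    by (intro wf_inv_image wf_lex_prod wf_less_than)
qed (use rank_move[OF assms] in auto)

text \<open>Atoms are left out since their winner is fixed by truth, not by who is stuck. Elsewhere
  a dead end needs no clause of its own: an empty choice falsifies the existential and verifies the
  universal, a loss for whoever must move.\<close>

lemma eloise_good_iff_move: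
  assumes "program_over Pi L" "legal L q"
    and "\<And>V v p l. q \<notin> {Pos V v Top l, Pos V v Bot l, Pos V v (Prp p) l}"
  shows "eloise_good M w L q \<longleftrightarrow>
    (if sg_turn q = Eloise then \<exists>q' \<in> sg_moves M w L q. eloise_good M w L q'
     else \<forall>q' \<in> sg_moves M w L q. eloise_good M w L q')"
proof (cases q)
  case Init
  \<comment> \<open>Base bodies are variable-free, so the round Eloise chooses along with one does
    not affect its value.\<close>
  have init: "sat M w (subst (iteration L l) (base_body L X)) \<longleftrightarrow> sat M w (iteration L 0 X)"
    if "X \<in> accepting L" for X l
    using that assms(1) by (auto simp: program_over_def subst_var_free)
  show ?thesis
  proof
    assume "eloise_good M w L q"
    then obtain n X where X: "X \<in> accepting L" "sat M w (iteration L n X)"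
      using Init by (auto simp: program_sat_def)
    show "if sg_turn q = Eloise then \<exists>q' \<in> sg_moves M w L q. eloise_good M w L q'
      else \<forall>q' \<in> sg_moves M w L q. eloise_good M w L q'"
    \<comment> \<open>Off by one: \<open>iteration L (Suc m) X\<close> is the value of the induction
      body at round \<open>m\<close>, whose variables stand for their \<open>m\<close>-th
      iterations.\<close>
    proof (cases n)
      case 0
      then have "eloise_good M w L (Pos Eloise w (base_body L X) 0)" using X init by simp
      then show ?thesis using Init X by fastforce
    next
      case (Suc m)
      then have "eloise_good M w L (Pos Eloise w (ind_body L X) m)" using X by simp
      then show ?thesis using Init X by fastforce
    qed
  next
    assume "if sg_turn q = Eloise then \<exists>q' \<in> sg_moves M w L q. eloise_good M w L q'
      else \<forall>q' \<in> sg_moves M w L q. eloise_good M w L q'"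
    then have "\<exists>l. \<exists>X \<in> accepting L. sat M w (subst (iteration L l) (base_body L X)) \<or>
      sat M w (subst (iteration L l) (ind_body L X))"
      using Init by (simp, metis eloise_good.simps(2))
    then obtain l X where X: "X \<in> accepting L"
      "sat M w (subst (iteration L l) (base_body L X)) \<or>
       sat M w (subst (iteration L l) (ind_body L X))"
      by blast
    then have "sat M w (iteration L 0 X) \<or> sat M w (iteration L (Suc l) X)"
      using init by auto
    then have "program_sat M w L" using X(1) unfolding program_sat_def by blast
    then show "eloise_good M w L q" using Init by simp
  qed
next
  case (Pick C V S \<psi> l)
  then show ?thesis by (simp add: all_image_iff ex_image_iff)
next
  case (Pos V v \<phi> l)
  show ?thesis
  proof (cases \<phi>)
    case (Var X)
    \<comment> \<open>Round 0 stays at 0 when a variable is replaced by its base body, which no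
      substitution changes; at positive rounds the values agree by the recursion of
      \<open>iteration\<close>.\<close>
    have "subst s (base_body L X) = base_body L X" for s
      using assms(1,2) Pos Var by (auto simp: program_over_def intro: subst_var_free)
    then show ?thesis using Pos Var by (cases l) auto
  next
    case (Dia k \<psi>)
    then show ?thesis using Pos by (cases V) (simp_all add: at_least_Collect_iff all_image_iff ex_image_iff)
  next
    case (Box k \<psi>)
    then show ?thesis using Pos by (cases V) (simp_all add: at_least_Collect_iff all_image_iff ex_image_iff)
  next
    case (GDia k \<psi>)
    then show ?thesis using Pos by (cases V) (simp_all add: at_least_Collect_iff all_image_iff ex_image_iff)
  next
    case (GBox k \<psi>)
    then show ?thesis using Pos by (cases V) (simp_all add: at_least_Collect_iff all_image_iff ex_image_iff)
  qed (use Pos assms(3) in \<open>cases V; auto\<close>)+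
qed

text \<open>Outside atoms the stuck player loses, which is the value that the empty quantifier
  already gives.\<close>

lemma consistent_at_semantic_game:
  assumes "program_over Pi L" "legal L q"
  shows "consistent_at (semantic_game M w L) Eloise (eloise_good M w L) q"
proof (cases "\<exists>V v p l. q \<in> {Pos V v Top l, Pos V v Bot l, Pos V v (Prp p) l}")
  case True
  then show ?thesis
    by (auto simp: consistent_at_def semantic_game_def opponent_eq_iff split: if_splits)
next
  case False
  then have "sg_winner M q = opponent (sg_turn q)"
    by (cases "(M, q)" rule: sg_winner.cases) auto
  then show ?thesis
    using eloise_good_iff_move[OF assms, of M w] False
    by (auto simp: consistent_at_def semantic_game_def opponent_eq_iff)
qed

theorem mainTheorem2:
  fixes Pi :: "'p set" and M :: "('w, 'p) model" and w :: 'w and L :: "('p, 'x) program"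
  assumes "model_over Pi M" and "w \<in> worlds M" and "program_over Pi L"
  shows "program_sat M w L \<longleftrightarrow> (\<exists>\<sigma>. winning_strategy (semantic_game M w L) Eloise \<sigma>)"
proof -
  have "(\<exists>\<sigma>. winning_strategy (semantic_game M w L) Eloise \<sigma>) \<longleftrightarrow>
    eloise_good M w L (start (semantic_game M w L))"
  proof (rule winning_strategy_exists_iff[where Q = "Collect (legal L)"])
    show "wf {(q', q). q \<in> Collect (legal L) \<and> q' \<in> moves (semantic_game M w L) q}"
      using wf_sg_moves[OF assms(3)] by (simp add: semantic_game_def)
    show "start (semantic_game M w L) \<in> Collect (legal L)"
      by (simp add: semantic_game_def)
    show "q' \<in> Collect (legal L)"
      if "q \<in> Collect (legal L)" "q' \<in> moves (semantic_game M w L) q" for q q'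
      using legal_move[OF assms(3)] that by (simp add: semantic_game_def)
    show "consistent_at (semantic_game M w L) Eloise (eloise_good M w L) q"
      if "q \<in> Collect (legal L)" for q
      using consistent_at_semantic_game[OF assms(3)] that by simp
  qed
  \<comment> \<open>The value of \<open>Init\<close> is \<open>program_sat M w L\<close> by
    definition.\<close>
  then show ?thesis by (simp add: semantic_game_def)
qed

end
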